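(* If $G$ is any graph of order $n\geq 3$ and $\overline{G}$ is its complement, then $$\mathrm{Mad}(G)+\mathrm{Mad}(\overline{G})\leq\begin{cases}(5n^2-6n+1)/(4n) & \text{if } n \text{ is odd},\\ (5n^2-6n)/(4n) & \text{if } n \text{ is even}.\end{cases}$$ Moreover, both bounds are tight, so $M(2,n)=5n/4-3/2+\epsilon_n$ for every $n\geq 3$, where $\epsilon_n=0$ if $n$ is even and $\epsilon_n=\frac{1}{4n}$ if $n$ is odd.
   Context: For a finite graph $G$, $\mathrm{Mad}(G)=\max\{2e(H)/|V(H)| : H\subseteq G,\ |V(H)|\geq 1\}$ ($0$ if $G$ has no edges). $M(k,n)$ denotes the maximum of $\sum_{i=1}^k\mathrm{Mad}(G_i)$ over all partitions of $E(K_n)$ into $k$ spanning subgraphs $G_1,\dots,G_k$; in particular $M(2,n)=\max\{\mathrm{Mad}(G)+\mathrm{Mad}(\overline{G}) : |V(G)|=n\}$. *)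

theory Defs
  imports Complex_Main "HOL-Library.Ramsey" "HOL-Library.Disjoint_Sets"
begin

text \<open>A finite simple graph is a finite vertex set together with a set of two-element
  subsets of it; \<^term>\<open>nsets V 2\<close> is the edge set of the complete graph on \<^term>\<open>V\<close>.\<close>

definition fin_graph :: "'a set \<Rightarrow> 'a set set \<Rightarrow> bool" where
  "fin_graph V E \<longleftrightarrow> finite V \<and> E \<subseteq> nsets V 2"

definition graph_compl :: "'a set \<Rightarrow> 'a set set \<Rightarrow> 'a set set" where
  "graph_compl V E = nsets V 2 - E"

definition subgraph_of :: "'a set \<Rightarrow> 'a set set \<Rightarrow> 'a set \<Rightarrow> 'a set set \<Rightarrow> bool" where
  "subgraph_of W F V E \<longleftrightarrow> fin_graph W F \<and> W \<subseteq> V \<and> F \<subseteq> E"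

definition Mad :: "'a set \<Rightarrow> 'a set set \<Rightarrow> real" where
  "Mad V E = (if E = {} then 0
     else Max {2 * real (card F) / real (card W) | W F. subgraph_of W F V E \<and> card W \<ge> 1})"

text \<open>A partition of the edges of the complete graph on \<^term>\<open>{..<n}\<close> into the edge sets of
  \<^term>\<open>k\<close> spanning subgraphs; parts may be empty.\<close>

definition edge_partition :: "nat \<Rightarrow> nat \<Rightarrow> (nat \<Rightarrow> nat set set) \<Rightarrow> bool" where
  "edge_partition k n G \<longleftrightarrow>
     (\<Union>i\<in>{1..k}. G i) = nsets {..<n} 2 \<and> disjoint_family_on G {1..k}"

definition M :: "nat \<Rightarrow> nat \<Rightarrow> real" where
  "M k n = Max {\<Sum>i=1..k. Mad {..<n} (G i) | G. edge_partition k n G}"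

text \<open>The sets whose maxima are taken above are finite and, in the relevant range, nonempty.\<close>

lemma Mad_set_finite:
  assumes "fin_graph V E"
  shows "finite {2 * real (card F) / real (card W) | W F. subgraph_of W F V E \<and> card W \<ge> 1}"
    (is "finite ?S")
proof -
  have "finite V" "finite E"
    using assms finite_subset[OF _ finite_imp_finite_nsets] by (auto simp: fin_graph_def)
  moreover have "?S \<subseteq> (\<lambda>(W, F). 2 * real (card F) / real (card W)) ` (Pow V \<times> Pow E)"
    by (auto simp: subgraph_of_def)
  ultimately show ?thesis
    by (meson finite_Pow_iff finite_SigmaI finite_imageI finite_subset)
qed

lemma Mad_set_nonempty:
  assumes "fin_graph V E" "V \<noteq> {}"
  shows "{2 * real (card F) / real (card W) | W F. subgraph_of W F V E \<and> card W \<ge> 1} \<noteq> {}"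
proof -
  have "subgraph_of V E V E" "card V \<ge> 1"
    using assms by (auto simp: subgraph_of_def fin_graph_def Suc_le_eq card_gt_0_iff)
  then show ?thesis by blast
qed

lemma M_set_finite: "finite {\<Sum>i=1..k. Mad {..<n} (G i) | G. edge_partition k n G}"
  (is "finite ?S")
proof -
  have "?S \<subseteq> (\<lambda>G. \<Sum>i=1..k. Mad {..<n} (G i)) ` (PiE {1..k} (\<lambda>_. Pow (nsets {..<n} 2)))"
  proof
    fix x assume "x \<in> ?S"
    then obtain G where x: "x = (\<Sum>i=1..k. Mad {..<n} (G i))" and G: "edge_partition k n G"
      by blast
    have "x = (\<Sum>i=1..k. Mad {..<n} (restrict G {1..k} i))"
      unfolding x by (intro sum.cong) auto
    moreover have "restrict G {1..k} \<in> PiE {1..k} (\<lambda>_. Pow (nsets {..<n} 2))"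
      using G unfolding edge_partition_def by (intro restrict_PiE_iff[THEN iffD2]) blast
    ultimately show "x \<in> (\<lambda>G. \<Sum>i=1..k. Mad {..<n} (G i)) ` (PiE {1..k} (\<lambda>_. Pow (nsets {..<n} 2)))"
      by blast
  qed
  moreover have "finite (PiE {1..k} (\<lambda>_. Pow (nsets {..<n::nat} 2)))"
    by (intro finite_PiE) (auto simp: finite_imp_finite_nsets)
  ultimately show ?thesis
    by (meson finite_imageI finite_subset)
qed

lemma M_2_eq:
  "M 2 n = Max {Mad {..<n} E + Mad {..<n} (graph_compl {..<n} E) | E. fin_graph {..<n} E}"
proof -
  have iv: "{1..2::nat} = {1, 2}" by auto
  have "{\<Sum>i=1..2. Mad {..<n} (G i) | G. edge_partition 2 n G}
      = {Mad {..<n} E + Mad {..<n} (graph_compl {..<n} E) | E. fin_graph {..<n} E}" (is "?A = ?B")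
  proof (intro equalityI subsetI)
    fix x assume "x \<in> ?A"
    then obtain G where x: "x = (\<Sum>i=1..2. Mad {..<n} (G i))" and G: "edge_partition 2 n G"
      by blast
    have "G 1 \<union> G 2 = nsets {..<n} 2" "G 1 \<inter> G 2 = {}"
      using G unfolding edge_partition_def iv disjoint_family_on_def by auto
    then have "fin_graph {..<n} (G 1)" "G 2 = graph_compl {..<n} (G 1)"
      by (auto simp: fin_graph_def graph_compl_def)
    then show "x \<in> ?B" unfolding x iv by auto
  next
    fix x assume "x \<in> ?B"
    then obtain E where x: "x = Mad {..<n} E + Mad {..<n} (graph_compl {..<n} E)"
      and E: "fin_graph {..<n} E" by blast
    define G where "G = (\<lambda>i::nat. if i = 1 then E else graph_compl {..<n} E)"
    have "edge_partition 2 n G"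
      using E unfolding edge_partition_def iv disjoint_family_on_def G_def
      by (auto simp: fin_graph_def graph_compl_def)
    moreover have "x = (\<Sum>i=1..2. Mad {..<n} (G i))"
      unfolding x iv G_def by simp
    ultimately show "x \<in> ?A" by blast
  qed
  then show ?thesis unfolding M_def by simp
qed

end

theory Submission
  imports Defs
begin

text \<open>Let \<open>A\<close> and \<open>B\<close>, of sizes \<open>a \<le> b\<close>, carry subgraphs attaining the two values of \<open>Mad\<close>.
  The pairs inside \<open>A \<inter> B\<close> are shared between the two edge sets, and an edge counts for more on
  the smaller set \<open>A\<close>, so the sum of the average degrees is at most
  \<open>a + b - 2 - c(c - 1)/b\<close> with \<open>c = |A \<inter> B|\<close>.  As \<open>c \<ge> d := a + b - n\<close> and \<open>b \<le> n\<close>, this is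
  at most \<open>n - 2 + d(n + 1 - d)/n\<close> when \<open>d \<ge> 1\<close> (and at most \<open>n - 2\<close> otherwise), a concave
  quadratic in the integer \<open>d\<close>.  Its maximum is
  attained by the clique on \<open>\<lceil>n/2\<rceil>\<close> vertices against the whole complement.\<close>

lemma Mad_attained:
  assumes "fin_graph V E" "V \<noteq> {}"
  obtains W F where "subgraph_of W F V E" "card W \<ge> 1"
    "Mad V E = 2 * real (card F) / real (card W)"
proof (cases "E = {}")
  case True
  \<comment> \<open>The definition sets \<open>Mad\<close> to 0 here, and the edgeless graph on all
    of \<open>V\<close> realizes that value.\<close>
  have "subgraph_of V {} V E" "card V \<ge> 1"
    using assms by (auto simp: subgraph_of_def fin_graph_def Suc_le_eq card_gt_0_iff)
  then show thesis
    using that[of V "{}"] True by (simp add: Mad_def)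
next
  case False
  then show thesis
    using Max_in[OF Mad_set_finite Mad_set_nonempty, OF assms(1) assms] that
    unfolding Mad_def by auto
qed

lemma Mad_ge:
  assumes "fin_graph V E" "subgraph_of W F V E" "card W \<ge> 1"
  shows "2 * real (card F) / real (card W) \<le> Mad V E"
proof (cases "E = {}")
  case True
  then show ?thesis using assms(2) by (simp add: subgraph_of_def Mad_def)
next
  case False
  then show ?thesis
    using Max_ge[OF Mad_set_finite[OF assms(1)]] assms(2,3) unfolding Mad_def by auto
qed

lemma fin_graph_compl: "finite V \<Longrightarrow> fin_graph V (graph_compl V E)"
  by (auto simp: fin_graph_def graph_compl_def)

lemma two_choose_two: "2 * real (n choose 2) = real n * (real n - 1)"
proof -
  have "2 * (n choose 2) = n * (n - 1)"
    using choose_two[of n] by (cases n) auto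
  then have "2 * real (n choose 2) = real (n * (n - 1))"
    by (metis of_nat_mult of_nat_numeral)
  then show ?thesis by (cases n) (auto simp: algebra_simps)
qed

text \<open>Disjointness lets the two cardinalities add up inside
  \<open>nsets A 2 \<union> nsets B 2\<close>. The two sets of pairs overlap in
  \<open>nsets (A \<inter> B) 2\<close>, so inclusion-exclusion finishes.\<close>

lemma card_disjoint_edges_le:
  assumes "finite A" "finite B" "F \<subseteq> nsets A 2" "F' \<subseteq> nsets B 2" "F \<inter> F' = {}"
  shows "card F + card F' + (card (A \<inter> B) choose 2) \<le> (card A choose 2) + (card B choose 2)"
proof -
  have fin: "finite (nsets A 2)" "finite (nsets B 2)"
    using assms by (simp_all add: finite_imp_finite_nsets)
  then have "finite F" "finite F'" using assms finite_subset by blast+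
  then have "card F + card F' = card (F \<union> F')"
    using assms(5) by (simp add: card_Un_disjoint)
  also have "\<dots> \<le> card (nsets A 2 \<union> nsets B 2)"
    using assms fin by (intro card_mono) auto
  finally have "card F + card F' \<le> card (nsets A 2 \<union> nsets B 2)" .
  moreover have "nsets A 2 \<inter> nsets B 2 = nsets (A \<inter> B) 2"
    by (auto simp: nsets_def)
  ultimately show ?thesis
    using card_Un_Int[OF fin] by simp
qed

text \<open>The floor is the product of the two nearly equal halves of \<open>m\<close>; for
  \<open>m = n + 1\<close> the first half is the size of the extremal clique.\<close>

lemma square_div_4:
  fixes m :: nat
  shows "m\<^sup>2 div 4 = (m div 2) * (m - m div 2)"
proof (cases "odd m")
  case True
  then obtain k where m: "m = 2 * k + 1" by (auto elim: oddE)
  have "m\<^sup>2 = 4 * (k * (k + 1)) + 1" by (simp add: m power2_eq_square algebra_simps)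
  then have "m\<^sup>2 div 4 = k * (k + 1)" by simp
  then show ?thesis by (simp add: m)
next
  case False
  then obtain k where m: "m = 2 * k" by (auto elim: evenE)
  then show ?thesis by (simp add: power2_eq_square)
qed

text \<open>The last numerator is the maximum of \<open>d * (n + 1 - d)\<close> over integers
  \<open>d\<close>; integer division lets one formula serve both parities.\<close>

definition mad_sum_max :: "nat \<Rightarrow> real" where
  "mad_sum_max n = real n - 2 + real ((n + 1)\<^sup>2 div 4) / real n"

lemma mad_sum_max_eq:
  assumes "n > 0"
  shows "mad_sum_max n =
    (if odd n then (5 * real n ^ 2 - 6 * real n + 1) / (4 * real n)
     else (5 * real n ^ 2 - 6 * real n) / (4 * real n))"
proof (cases "odd n")
  case True
  then obtain k where n: "n = 2 * k + 1" by (auto elim: oddE)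
  show ?thesis
    using True unfolding mad_sum_max_def square_div_4
    by (simp add: n field_simps power2_eq_square)
next
  case False
  then obtain k where n: "n = 2 * k" by (auto elim: evenE)
  show ?thesis
    using False assms unfolding mad_sum_max_def square_div_4
    by (simp add: n field_simps power2_eq_square)
qed

text \<open>With \<open>e = m - d\<close> this is \<open>(d - e)\<^sup>2 \<ge> 0\<close>; the floor
  costs nothing because the left side is an integer.\<close>

lemma mult_le_square_div_4:
  fixes d m :: nat
  assumes "d \<le> m"
  shows "d * (m - d) \<le> m\<^sup>2 div 4"
proof -
  obtain e where m: "m = d + e" using assms le_Suc_ex by blast
  have "4 * (d * e) \<le> (d + e)\<^sup>2"
    using sum_squares_ge_zero[of "int d - int e" 0]
    unfolding of_nat_le_iff[where 'a = int, symmetric]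
    by (simp add: power2_eq_square algebra_simps)
  then show ?thesis by (simp add: m less_eq_div_iff_mult_less_eq mult.commute)
qed

lemma average_degree_sum_le:
  assumes V: "finite V" "card V = n" and AB: "A \<subseteq> V" "B \<subseteq> V" "card A \<ge> 1"
    and le: "card A \<le> card B"
    and F: "F \<subseteq> nsets A 2" "F' \<subseteq> nsets B 2" "F \<inter> F' = {}"
  shows "2 * real (card F) / real (card A) + 2 * real (card F') / real (card B) \<le> mad_sum_max n"
proof -
  define a b c where "a = card A" and "b = card B" and "c = card (A \<inter> B)"
  have fin: "finite A" "finite B" using AB V finite_subset by blast+
  have ab: "1 \<le> a" "a \<le> b" "b \<le> n"
    using AB V le card_mono by (auto simp: a_def b_def)
  have "a + b = card (A \<union> B) + c"
    unfolding a_def b_def c_def by (rule card_Un_Int[OF fin])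
  moreover have "card (A \<union> B) \<le> n" using AB V card_mono[of V "A \<union> B"] by simp
  ultimately have c: "a + b \<le> n + c" by simp
  have sum_le: "2 * real (card F) + 2 * real (card F') + real c * (real c - 1)
      \<le> real a * (real a - 1) + real b * (real b - 1)"
    using card_disjoint_edges_le[OF fin F]
    unfolding two_choose_two[symmetric] a_def b_def c_def by linarith
  have "card F \<le> a choose 2"
    using card_mono[OF finite_imp_finite_nsets[OF fin(1)] F(1)] by (simp add: a_def)
  then have F_le: "2 * real (card F) \<le> real a * (real a - 1)"
    unfolding two_choose_two[symmetric] by linarith
  \<comment> \<open>Splitting \<open>1 / a\<close> as \<open>(1 / a - 1 / b) + 1 / b\<close> leaves
    two weights that are nonnegative because \<open>a \<le> b\<close>. The first takes the bound on
    \<open>card F\<close> alone, the second the joint bound \<open>sum_le\<close>.\<close>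
  have "2 * real (card F) / a + 2 * real (card F') / b
      = 2 * real (card F) * (1 / a - 1 / b) + (2 * real (card F) + 2 * real (card F')) / b"
    by (simp add: algebra_simps add_divide_distrib)
  also have "\<dots> \<le> real a * (real a - 1) * (1 / a - 1 / b)
      + (real a * (real a - 1) + real b * (real b - 1) - real c * (real c - 1)) / b"
    using F_le sum_le ab
    by (intro add_mono mult_right_mono divide_right_mono) (auto simp: frac_le)
  also have "\<dots> = real a + real b - 2 - real c * (real c - 1) / b"
    using ab by (simp add: field_simps)
  finally have main: "2 * real (card F) / a + 2 * real (card F') / b
      \<le> real a + real b - 2 - real c * (real c - 1) / b" .
  show ?thesis
  proof (cases "a + b \<le> n")
    case True
    \<comment> \<open>Integrality of \<open>c\<close> matters: the product is negative strictly
      between 0 and 1.\<close>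
    have "real c * (real c - 1) / b \<ge> 0" by (cases c) auto
    moreover have "real a + real b \<le> n" using True by linarith
    moreover have "real n - 2 \<le> mad_sum_max n" by (simp add: mad_sum_max_def)
    ultimately show ?thesis using main unfolding a_def b_def by linarith
  next
    case False
    define d where "d = a + b - n"
    have d: "1 \<le> d" "d \<le> c" "d \<le> n" "a + b = n + d" using False c ab by (auto simp: d_def)
    \<comment> \<open>Since \<open>d \<ge> 1\<close>, the factor \<open>d - 1\<close> is
      nonnegative, so lowering \<open>c\<close> to \<open>d\<close> and raising \<open>b\<close> to
      \<open>n\<close> can only shrink the subtracted term.\<close>
    have "real d * (real d - 1) / n \<le> real c * (real c - 1) / b"
      using d ab by (intro frac_le mult_mono) auto
    moreover have "real a + real b = real n + real d" using d(4) by linarith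
    moreover have "real d - real d * (real d - 1) / n = real (d * (n + 1 - d)) / n"
      using d by (simp add: of_nat_diff field_simps)
    moreover have "real (d * (n + 1 - d)) / n \<le> real ((n + 1)\<^sup>2 div 4) / n"
      using mult_le_square_div_4[of d "n + 1"] d by (intro divide_right_mono of_nat_mono) auto
    ultimately show ?thesis
      using main unfolding a_def b_def mad_sum_max_def by linarith
  qed
qed

lemma Mad_sum_le:
  assumes G: "fin_graph V E" and n: "card V = n" "n > 0"
  shows "Mad V E + Mad V (graph_compl V E) \<le> mad_sum_max n"
proof -
  have V: "finite V" "V \<noteq> {}" using G n by (auto simp: fin_graph_def)
  obtain A F where A: "subgraph_of A F V E" "card A \<ge> 1"
      "Mad V E = 2 * real (card F) / real (card A)"
    using Mad_attained[OF G V(2)] .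
  obtain B F' where B: "subgraph_of B F' V (graph_compl V E)" "card B \<ge> 1"
      "Mad V (graph_compl V E) = 2 * real (card F') / real (card B)"
    using Mad_attained[OF fin_graph_compl[OF V(1)] V(2)] .
  have "A \<subseteq> V" "B \<subseteq> V" "F \<subseteq> nsets A 2" "F' \<subseteq> nsets B 2" "F \<inter> F' = {}" "F' \<inter> F = {}"
    using A(1) B(1) by (auto simp: subgraph_of_def fin_graph_def graph_compl_def)
  \<comment> \<open>\<open>average_degree_sum_le\<close> wants the smaller vertex set first. It asks
    of \<open>F\<close> and \<open>F'\<close> only that they be disjoint edge sets, so the roles are
    exchanged when \<open>B\<close> is smaller.\<close>
  then show ?thesis
    using average_degree_sum_le[OF V(1) n(1), of A B F F']
      average_degree_sum_le[OF V(1) n(1), of B A F' F] A(2,3) B(2,3)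
    by (cases "card A \<le> card B") auto
qed

text \<open>The clique size is the integer maximizing \<open>d * (n + 1 - d)\<close>. Only lower
  bounds for the two \<open>Mad\<close> values are computed, from the clique and from the whole
  complement; \<open>Mad_sum_le\<close> then forces equality.\<close>

lemma Mad_sum_clique:
  assumes "n > 0"
  defines "E \<equiv> nsets {..<(n + 1) div 2} 2"
  shows "fin_graph {..<n} E"
    and "Mad {..<n} E + Mad {..<n} (graph_compl {..<n} E) = mad_sum_max n"
proof -
  define a where "a = (n + 1) div 2"
  have a: "1 \<le> a" "a \<le> n" using assms by (auto simp: a_def)
  have E: "E \<subseteq> nsets {..<n} 2"
    using a unfolding E_def a_def[symmetric] by (intro nsets_mono) auto
  then show G: "fin_graph {..<n} E" by (simp add: fin_graph_def)
  have cardE: "card E = a choose 2" by (simp add: E_def a_def)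
  have fin: "finite E" by (simp add: E_def finite_imp_finite_nsets)
  have "card (graph_compl {..<n} E) = (n choose 2) - (a choose 2)"
    using E fin by (simp add: graph_compl_def card_Diff_subset cardE)
  moreover have "(a choose 2) \<le> (n choose 2)"
    using card_mono[OF _ E] by (simp add: cardE finite_imp_finite_nsets)
  ultimately have compl: "2 * real (card (graph_compl {..<n} E))
      = real n * (real n - 1) - real a * (real a - 1)"
    unfolding two_choose_two[symmetric] by (simp add: of_nat_diff)
  have "subgraph_of {..<a} E {..<n} E"
    using a by (auto simp: subgraph_of_def fin_graph_def E_def a_def)
  from Mad_ge[OF G this] have "real a - 1 \<le> Mad {..<n} E"
    using a two_choose_two[of a] by (simp add: cardE)
  moreover have "subgraph_of {..<n} (graph_compl {..<n} E) {..<n} (graph_compl {..<n} E)"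
    by (auto simp: subgraph_of_def fin_graph_compl)
  from Mad_ge[OF fin_graph_compl this]
  have "(real n * (real n - 1) - real a * (real a - 1)) / n \<le> Mad {..<n} (graph_compl {..<n} E)"
    using assms(1) compl by simp
  moreover have "mad_sum_max n
      = real a - 1 + (real n * (real n - 1) - real a * (real a - 1)) / n"
    using assms(1) a unfolding mad_sum_max_def square_div_4 a_def[symmetric]
    by (simp add: of_nat_diff field_simps)
  ultimately show "Mad {..<n} E + Mad {..<n} (graph_compl {..<n} E) = mad_sum_max n"
    using Mad_sum_le[OF G] assms(1) by (intro antisym) auto
qed

lemma M_2:
  assumes "n > 0"
  shows "M 2 n = mad_sum_max n"
  unfolding M_2_eq
proof (rule Max_eqI)
  have "finite {E. fin_graph {..<n} E}"
    by (rule finite_subset[of _ "Pow (nsets {..<n} 2)"])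
      (auto simp: fin_graph_def finite_imp_finite_nsets)
  then show "finite {Mad {..<n} E + Mad {..<n} (graph_compl {..<n} E) |E. fin_graph {..<n} E}"
    by simp
  show "mad_sum_max n
      \<in> {Mad {..<n} E + Mad {..<n} (graph_compl {..<n} E) |E. fin_graph {..<n} E}"
    using Mad_sum_clique[OF assms] by force
qed (use Mad_sum_le[OF _ card_lessThan assms] in auto)

theorem theorem4p1:
  fixes n :: nat
  assumes "n \<ge> 3"
  shows "(\<forall>(V :: 'a set) E. fin_graph V E \<and> card V = n \<longrightarrow>
            Mad V E + Mad V (graph_compl V E) \<le>
              (if odd n then (5 * real n ^ 2 - 6 * real n + 1) / (4 * real n)
               else (5 * real n ^ 2 - 6 * real n) / (4 * real n)))
       \<and> (\<exists>(V :: nat set) E. fin_graph V E \<and> card V = n \<and>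
            Mad V E + Mad V (graph_compl V E) =
              (if odd n then (5 * real n ^ 2 - 6 * real n + 1) / (4 * real n)
               else (5 * real n ^ 2 - 6 * real n) / (4 * real n)))
       \<and> M 2 n = 5 * real n / 4 - 3 / 2 + (if even n then 0 else 1 / (4 * real n))"
proof -
  have n: "n > 0" using assms by simp
  \<comment> \<open>All three claims are compared with \<open>mad_sum_max n\<close>, so parity
    enters only through this identity and \<open>mad_sum_max_eq\<close>.\<close>
  have "5 * real n / 4 - 3 / 2 + (if even n then 0 else 1 / (4 * real n)) = mad_sum_max n"
    using n by (simp add: mad_sum_max_eq field_simps power2_eq_square)
  moreover have "\<exists>(V :: nat set) E. fin_graph V E \<and> card V = n \<and>
      Mad V E + Mad V (graph_compl V E) = mad_sum_max n"
    using Mad_sum_clique[OF n] card_lessThan by blast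
  ultimately show ?thesis
    unfolding mad_sum_max_eq[OF n, symmetric] using Mad_sum_le[OF _ _ n] M_2[OF n] by auto
qed

end
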